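(* The set $\Omega_P\cup\Omega_Q\subset\mathbb{R}^2$ has Hausdorff dimension exactly $1$ (in particular it has two-dimensional Lebesgue measure zero).
   Context: For real parameters $a,b$, the map $T_{ab}:\mathbb{R}^2\to\mathbb{R}^2$ is $T_{ab}(x,y)=(ax-y,x)$ if $x\ge 0$ and $T_{ab}(x,y)=(bx-y,x)$ if $x<0$; $T_{ab}^{(k)}$ is its $k$-th iterate. $S_{ab}:S^1\to S^1$, $S_{ab}(\mathbf{u})=T_{ab}(\mathbf{u})/|T_{ab}(\mathbf{u})|$, and $r(S_{ab})$ is its Poincaré rotation number. $\Omega_P$ is the set of $(a,b)\in\mathbb{R}^2$ for which $T_{ab}$ is periodic, i.e. $T_{ab}^{(k)}$ is the identity for some $k\ge1$. $\Omega_Q$ is the set of $(a,b)\in\mathbb{R}^2$ for which $r(S_{ab})$ is irrational and the $S_{ab}$-orbit of $(0,1)$ contains $(0,-1)$. *)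

theory Defs
  imports "HOL-Analysis.Analysis"
begin

definition T_map :: "real \<Rightarrow> real \<Rightarrow> real \<times> real \<Rightarrow> real \<times> real" where
  "T_map a b p = (if fst p \<ge> 0 then (a * fst p - snd p, fst p) else (b * fst p - snd p, fst p))"

definition S_map :: "real \<Rightarrow> real \<Rightarrow> real \<times> real \<Rightarrow> real \<times> real" where
  "S_map a b u = (1 / norm (T_map a b u)) *\<^sub>R T_map a b u"

definition circ :: "real \<Rightarrow> real \<times> real" where
  "circ t = (cos (2 * pi * t), sin (2 * pi * t))"

definition rotation_number :: "(real \<times> real \<Rightarrow> real \<times> real) \<Rightarrow> real" where
  "rotation_number S =
     (let F = (SOME F. continuous_on UNIV F \<and> (\<forall>t. circ (F t) = S (circ t)))
      in frac (lim (\<lambda>n. (F ^^ n) 0 / real n)))"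

definition Omega_P :: "(real \<times> real) set" where
  "Omega_P = {(a, b). \<exists>k::nat. k \<ge> 1 \<and> (T_map a b ^^ k) = id}"

definition Omega_Q :: "(real \<times> real) set" where
  "Omega_Q = {(a, b). rotation_number (S_map a b) \<notin> \<rat> \<and>
                      (\<exists>n::nat. (S_map a b ^^ n) (0, 1) = (0, -1))}"

definition hsize :: "real \<Rightarrow> 'a::metric_space set \<Rightarrow> real" where
  "hsize s C = (if C = {} then 0 else if s = 0 then 1 else diameter C powr s)"

definition hausdorff_pre :: "real \<Rightarrow> real \<Rightarrow> 'a::metric_space set \<Rightarrow> ennreal" where
  "hausdorff_pre s \<delta> A =
     (INF C \<in> {C :: nat \<Rightarrow> 'a set. A \<subseteq> (\<Union>i. C i) \<and>
                 (\<forall>i. bounded (C i) \<and> diameter (C i) \<le> \<delta>)}.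
        (\<Sum>i. ennreal (hsize s (C i))))"

definition hausdorff_measure :: "real \<Rightarrow> 'a::metric_space set \<Rightarrow> ennreal" where
  "hausdorff_measure s A = (SUP \<delta> \<in> {0<..}. hausdorff_pre s \<delta> A)"

definition hausdorff_dim :: "'a::metric_space set \<Rightarrow> real" where
  "hausdorff_dim A = Inf {s. s \<ge> 0 \<and> hausdorff_measure s A = 0}"

end

theory Submission
  imports Defs
begin

text \<open>
  Upper bound. If the orbit of \<open>(0, 1)\<close> reaches \<open>(0, -1)\<close>, or returns to \<open>(0, 1)\<close>, then
  \<open>T\<^sup>n (0, 1)\<close> lies on the vertical axis for some \<open>n \<ge> 2\<close>. Fix \<open>n\<close> and the signs of the first
  coordinates along the orbit. Comparing the orbits for \<open>(a, b)\<close> and \<open>(a', b')\<close> with \<open>a < a'\<close> and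
  \<open>b < b'\<close>, their Wronskian never decreases and becomes positive at step two, as in Sturm's comparison
  theorem, whereas it vanishes at step \<open>n\<close>. So the parameters with these data form an antitone relation,
  on which \<open>a - b\<close> is a coordinate with 1-Lipschitz inverse, and there are countably many such data.

  Lower bound. For \<open>b = 0\<close> one has \<open>T\<^sup>2 (0, 1) = (0, -1)\<close>, and up to sign and a time change \<open>T\<close> acts
  as the linear map with trace \<open>a\<close> and determinant \<open>1\<close>. For \<open>a = 2 cos (\<pi> \<alpha>)\<close> with \<open>\<alpha>\<close>
  irrational, \<open>S\<close> then has no periodic point, hence irrational rotation number. So all but countably
  many points of the segment \<open>]-2, 2[ \<times> {0}\<close> belong to \<open>Omega_Q\<close>.
\<close>

section \<open>Sign patterns and the Wronskian\<close>

lemma snd_T_map [simp]: "snd (T_map a b p) = fst p"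
  by (simp add: T_map_def)

text \<open>An orbit point lists two consecutive terms of a second-order recurrence, so this
  determinant is the discrete Wronskian of two solutions.\<close>

definition cross2 :: "real \<times> real \<Rightarrow> real \<times> real \<Rightarrow> real" where
  "cross2 p q = snd p * fst q - fst p * snd q"

text \<open>The increment is exactly \<open>(a' - a) * (fst p * fst q)\<close>, or the same with
  \<open>b\<close>, and equal signs make it nonnegative.\<close>

lemma cross2_T_map_mono:
  assumes "a \<le> a'" "b \<le> b'" "fst p \<ge> 0 \<longleftrightarrow> fst q \<ge> 0"
  shows "cross2 p q \<le> cross2 (T_map a b p) (T_map a' b' q)"
proof (cases "fst p \<ge> 0")
  case True
  then have "(a' - a) * (fst p * fst q) \<ge> 0" using assms by simp
  then show ?thesis using True assms by (simp add: cross2_def T_map_def algebra_simps)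
next
  case False
  then have "fst p * fst q \<ge> 0" using assms by (intro mult_nonpos_nonpos) auto
  then have "(b' - b) * (fst p * fst q) \<ge> 0" using assms by simp
  then show ?thesis using False assms by (simp add: cross2_def T_map_def algebra_simps)
qed

text \<open>Fixing the signs before time \<open>n\<close> fixes the linear branch applied at each of
  the \<open>n\<close> steps, which makes two parameters comparable.\<close>

definition sign_curve :: "nat \<Rightarrow> nat set \<Rightarrow> (real \<times> real) set" where
  "sign_curve n J = {(a, b). fst ((T_map a b ^^ n) (0, 1)) = 0 \<and>
     {j. j < n \<and> fst ((T_map a b ^^ j) (0, 1)) \<ge> 0} = J}"

lemma sign_curve_not_less:
  assumes "n \<ge> 2" "(a, b) \<in> sign_curve n J" "(a', b') \<in> sign_curve n J" "a < a'"
  shows "\<not> b < b'"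
proof
  assume "b < b'"
  define p where "p j = (T_map a b ^^ j) (0, 1)" for j
  define q where "q j = (T_map a' b' ^^ j) (0, 1)" for j
  have same: "fst (p j) \<ge> 0 \<longleftrightarrow> fst (q j) \<ge> 0" if "j < n" for j
    using assms(2,3) that unfolding sign_curve_def p_def q_def by blast
  \<comment> \<open>Step 2 is the first at which the orbits can differ: the second iterate of
    \<open>(0, 1)\<close> is \<open>(- b, - 1)\<close>, so the Wronskian there equals
    \<open>b' - b\<close>.\<close>
  have "cross2 (p j) (q j) \<ge> b' - b" if "2 \<le> j" "j \<le> n" for j
    using that
  proof (induction j rule: dec_induct)
    case base
    then show ?case by (simp add: p_def q_def cross2_def T_map_def numeral_2_eq_2)
  next
    case (step j)
    have "cross2 (p j) (q j) \<le> cross2 (p (Suc j)) (q (Suc j))"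
      using cross2_T_map_mono[of a a' b b' "p j" "q j"] same[of j] step \<open>a < a'\<close> \<open>b < b'\<close>
      by (simp add: p_def q_def)
    then show ?case using step by simp
  qed
  from this[of n] have "cross2 (p n) (q n) > 0" using \<open>b < b'\<close> \<open>n \<ge> 2\<close> by simp
  moreover have "cross2 (p n) (q n) = 0"
    using assms by (simp add: sign_curve_def p_def q_def cross2_def)
  ultimately show False by simp
qed

text \<open>The product form also admits vertical segments, so the relation need not be the graph of
  a function.\<close>

definition antitone_set :: "(real \<times> real) set \<Rightarrow> bool" where
  "antitone_set Z \<longleftrightarrow> (\<forall>p\<in>Z. \<forall>q\<in>Z. (fst p - fst q) * (snd p - snd q) \<le> 0)"

lemma antitone_sign_curve:
  assumes "n \<ge> 2" shows "antitone_set (sign_curve n J)"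
  unfolding antitone_set_def
proof (intro ballI)
  fix p q assume pq: "p \<in> sign_curve n J" "q \<in> sign_curve n J"
  obtain a b a' b' where [simp]: "p = (a, b)" "q = (a', b')" by (metis prod.exhaust)
  have "a < a' \<Longrightarrow> b \<ge> b'" "a' < a \<Longrightarrow> b' \<ge> b"
    using sign_curve_not_less[OF assms] pq by force+
  then show "(fst p - fst q) * (snd p - snd q) \<le> 0"
    by (cases a a' rule: linorder_cases) (auto simp: mult_le_0_iff)
qed

section \<open>Positive homogeneity and the passage from \<open>S_map\<close> to
  \<open>T_map\<close>\<close>

lemma T_map_scaleR: "c \<ge> 0 \<Longrightarrow> T_map a b (c *\<^sub>R p) = c *\<^sub>R T_map a b p"
  by (cases "c = 0") (auto simp: T_map_def prod_eq_iff zero_le_mult_iff algebra_simps)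

lemma T_map_eq_0_iff [simp]: "T_map a b p = 0 \<longleftrightarrow> p = 0"
  by (auto simp: T_map_def prod_eq_iff)

lemma T_map_pow_eq_0_iff [simp]: "(T_map a b ^^ n) p = 0 \<longleftrightarrow> p = 0"
  by (induction n) auto

text \<open>Homogeneity lets all normalisations be pulled out in front; the factor is positive, so
  rays and not merely lines are tracked.\<close>

lemma S_map_pow:
  assumes "p \<noteq> 0"
  shows "\<exists>c>0. (S_map a b ^^ n) p = c *\<^sub>R (T_map a b ^^ n) p"
proof (induction n)
  case 0
  then show ?case by (intro exI[of _ 1]) auto
next
  case (Suc n)
  then obtain c where c: "c > 0" "(S_map a b ^^ n) p = c *\<^sub>R (T_map a b ^^ n) p" by blast
  have "(S_map a b ^^ Suc n) p = (1 / norm (T_map a b ((T_map a b ^^ n) p))) *\<^sub>R (T_map a b ^^ Suc n) p"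
    using c by (simp add: S_map_def T_map_scaleR)
  moreover have "norm (T_map a b ((T_map a b ^^ n) p)) > 0" using assms by simp
  ultimately show ?case by (intro exI[of _ "1 / norm (T_map a b ((T_map a b ^^ n) p))"]) auto
qed

lemma Omega_subset_sign_curves:
  "Omega_P \<union> Omega_Q \<subseteq> (\<Union>n\<in>{2..}. \<Union>J\<in>Pow {..<n}. sign_curve n J)"
proof -
  have ge2: "n \<ge> 2 \<and> fst ((T_map a b ^^ n) (0, 1)) = 0"
    if "(T_map a b ^^ n) (0, 1) = (0, c)" "n > 0" for a b c n
  proof -
    \<comment> \<open>One step takes \<open>(0, 1)\<close> to \<open>(- 1, 0)\<close>, off the
      vertical axis.\<close>
    have "n \<noteq> 1" using that by (auto simp: T_map_def)
    then show ?thesis using that by auto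
  qed
  have P: "\<exists>n. n \<ge> 2 \<and> fst ((T_map a b ^^ n) (0, 1)) = 0" if mem: "(a, b) \<in> Omega_P" for a b
  proof -
    obtain n where "n \<ge> 1" "T_map a b ^^ n = id" using mem unfolding Omega_P_def by auto
    then show ?thesis using ge2[of n a b 1] by auto
  qed
  have Q: "\<exists>n. n \<ge> 2 \<and> fst ((T_map a b ^^ n) (0, 1)) = 0" if mem: "(a, b) \<in> Omega_Q" for a b
  proof -
    obtain n where n: "(S_map a b ^^ n) (0, 1) = (0, -1)" using mem unfolding Omega_Q_def by auto
    obtain c where "c > 0" "(0, -1) = c *\<^sub>R (T_map a b ^^ n) (0, 1)"
      using S_map_pow[of "(0, 1)" n a b] n by (auto simp: zero_prod_def)
    then have "(T_map a b ^^ n) (0, 1) = (0, - 1 / c)" by (auto simp: prod_eq_iff field_simps)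
    moreover have "n \<noteq> 0" using n by (cases n) auto
    ultimately show ?thesis using ge2 by blast
  qed
  show ?thesis
  proof
    fix p assume p: "p \<in> Omega_P \<union> Omega_Q"
    obtain a b where [simp]: "p = (a, b)" by (metis prod.exhaust)
    obtain n where "n \<ge> 2" "fst ((T_map a b ^^ n) (0, 1)) = 0" using p P[of a b] Q[of a b] by auto
    then have "p \<in> sign_curve n {j. j < n \<and> fst ((T_map a b ^^ j) (0, 1)) \<ge> 0}"
      by (simp add: sign_curve_def)
    moreover have "{j. j < n \<and> fst ((T_map a b ^^ j) (0, 1)) \<ge> 0} \<in> Pow {..<n}" by auto
    ultimately show "p \<in> (\<Union>n\<in>{2..}. \<Union>J\<in>Pow {..<n}. sign_curve n J)"
      using \<open>n \<ge> 2\<close> by blast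
  qed
qed

text \<open>If d and e are the coordinate differences, then d e \<le> 0 and hence d^2 + e^2 \<le> (d
  - e)^2.\<close>

lemma dist_antitone:
  assumes "antitone_set Z" "p \<in> Z" "q \<in> Z"
  shows "dist p q \<le> \<bar>(fst p - snd p) - (fst q - snd q)\<bar>"
proof -
  have "(fst p - fst q) * (snd p - snd q) \<le> 0" using assms by (auto simp: antitone_set_def)
  moreover have "\<bar>(fst p - snd p) - (fst q - snd q)\<bar>\<^sup>2
      = (fst p - fst q)\<^sup>2 + (snd p - snd q)\<^sup>2 - 2 * ((fst p - fst q) * (snd p - snd q))"
    by (simp add: power2_eq_square algebra_simps)
  ultimately have "(fst p - fst q)\<^sup>2 + (snd p - snd q)\<^sup>2 \<le> \<bar>(fst p - snd p) - (fst q - snd q)\<bar>\<^sup>2"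
    by linarith
  then show ?thesis unfolding dist_prod_def dist_real_def power2_abs
    by (metis abs_ge_zero real_le_lsqrt power2_abs)
qed

lemma negligible_antitone:
  assumes "antitone_set Z" shows "negligible Z"
proof -
  \<comment> \<open>Padding with 0 places the coordinate \<open>fst p - snd p\<close> on a line in
    the plane, which is negligible; the inverse \<open>g\<close> is 1-Lipschitz, so its image is
    negligible too.\<close>
  define u where "u p = (fst p - snd p, 0::real)" for p :: "real \<times> real"
  have inj: "inj_on u Z"
    using dist_antitone[OF assms] by (force simp: inj_on_def u_def)
  define g where "g = inv_into Z u"
  have "negligible (u ` Z)"
  proof (rule negligible_subset)
    show "negligible {p :: real \<times> real. (0, 1) \<bullet> p = 0}"
      by (rule negligible_hyperplane) (simp add: zero_prod_def)
    show "u ` Z \<subseteq> {p. (0, 1) \<bullet> p = 0}" by (auto simp: u_def)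
  qed
  then have "negligible (g ` u ` Z)"
  proof (rule negligible_locally_Lipschitz_image[rotated])
    fix x assume x: "x \<in> u ` Z"
    have "norm (g y - g x) \<le> 1 * norm (y - x)" if y: "y \<in> u ` Z" for y
    proof -
      obtain p q where pq: "p \<in> Z" "q \<in> Z" "x = u p" "y = u q" using x y by auto
      then have "g x = p" "g y = q" using inj by (auto simp: g_def)
      moreover have "norm (y - x) = \<bar>(fst q - snd q) - (fst p - snd p)\<bar>"
        using pq by (simp add: u_def norm_Pair)
      ultimately show ?thesis using dist_antitone[OF assms pq(2,1)] by (simp add: dist_norm)
    qed
    then show "\<exists>T B. open T \<and> x \<in> T \<and> (\<forall>y\<in>u ` Z \<inter> T. norm (g y - g x) \<le> B * norm (y - x))"
      by (intro exI[of _ UNIV] exI[of _ 1]) auto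
  qed simp
  moreover have "g ` u ` Z = Z" using inj by (simp add: g_def image_inv_into_cancel image_image)
  ultimately show ?thesis by simp
qed

section \<open>Hausdorff measure of antitone sets\<close>

lemma hausdorff_pre_le:
  assumes "A \<subseteq> (\<Union>i. C i)" "\<And>i. bounded (C i)" "\<And>i. diameter (C i) \<le> \<delta>"
  shows "hausdorff_pre s \<delta> A \<le> (\<Sum>i. ennreal (hsize s (C i)))"
  unfolding hausdorff_pre_def by (rule INF_lower) (use assms in auto)

lemma hausdorff_pre_less:
  assumes "hausdorff_pre s \<delta> A < e"
  obtains C where "A \<subseteq> (\<Union>i. C i)" "\<And>i. bounded (C i)" "\<And>i. diameter (C i) \<le> \<delta>"
    "(\<Sum>i. ennreal (hsize s (C i))) < e"
  using assms unfolding hausdorff_pre_def INF_less_iff by blast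

lemma hausdorff_pre_mono: "A \<subseteq> B \<Longrightarrow> hausdorff_pre s \<delta> A \<le> hausdorff_pre s \<delta> B"
  unfolding hausdorff_pre_def by (rule INF_superset_mono) auto

lemma hausdorff_pre_UN_eq_0:
  fixes A :: "nat \<Rightarrow> 'a::metric_space set"
  assumes "\<And>m. hausdorff_pre s \<delta> (A m) = 0"
  shows "hausdorff_pre s \<delta> (\<Union>m. A m) = 0"
proof -
  have le: "hausdorff_pre s \<delta> (\<Union>m. A m) \<le> 0 + ennreal e" if "e > 0" for e
  proof -
    \<comment> \<open>Each \<open>A m\<close> gets the share e / 2^(m+1), and these shares sum to
      \<open>e\<close>.\<close>
    have "\<exists>C. A m \<subseteq> (\<Union>i. C i) \<and> (\<forall>i. bounded (C i) \<and> diameter (C i) \<le> \<delta>) \<and>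
       (\<Sum>i. ennreal (hsize s (C i))) < ennreal (e * (1/2) ^ Suc m)" for m
    proof -
      have "hausdorff_pre s \<delta> (A m) < ennreal (e * (1/2) ^ Suc m)"
        using assms \<open>e > 0\<close> by (simp add: ennreal_zero_less_mult_iff)
      then show ?thesis by (rule hausdorff_pre_less) blast
    qed
    then obtain C where C: "\<And>m. A m \<subseteq> (\<Union>i. C m i)" "\<And>m i. bounded (C m i)"
      "\<And>m i. diameter (C m i) \<le> \<delta>"
      "\<And>m. (\<Sum>i. ennreal (hsize s (C m i))) < ennreal (e * (1/2) ^ Suc m)"
      by metis
    define D where "D k = (case prod_decode k of (m, i) \<Rightarrow> C m i)" for k
    have "hausdorff_pre s \<delta> (\<Union>m. A m) \<le> (\<Sum>k. ennreal (hsize s (D k)))"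
    proof (rule hausdorff_pre_le)
      show "(\<Union>m. A m) \<subseteq> (\<Union>k. D k)"
      proof
        fix x assume "x \<in> (\<Union>m. A m)"
        then obtain m i where "x \<in> C m i" using C(1) by blast
        then have "x \<in> D (prod_encode (m, i))" by (simp add: D_def)
        then show "x \<in> (\<Union>k. D k)" by blast
      qed
    qed (use C in \<open>auto simp: D_def split: prod.split\<close>)
    also have "\<dots> = (\<Sum>m. \<Sum>i. ennreal (hsize s (C m i)))"
      using suminf_ennreal_2dimen[of _ "\<lambda>(m, i). ennreal (hsize s (C m i))"]
      by (simp add: D_def case_prod_unfold)
    also have "\<dots> \<le> (\<Sum>m. ennreal (e * (1/2) ^ Suc m))"
      by (intro suminf_le less_imp_le C(4)) auto
    also have "\<dots> = ennreal e"
      using sums_mult[OF power_half_series, of e] \<open>e > 0\<close>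
      by (intro suminf_ennreal_eq) auto
    finally show ?thesis by simp
  qed
  have "hausdorff_pre s \<delta> (\<Union>m. A m) \<le> 0" by (rule ennreal_le_epsilon) (rule le)
  then show ?thesis by simp
qed

text \<open>Cutting the unit range of the coordinate into N equal pieces covers \<open>Z\<close> by
  N sets of diameter at most 1/N, at cost N * (1/N)^s = N^(1-s), which tends to 0.\<close>

lemma hausdorff_pre_antitone_strip:
  assumes Z: "antitone_set Z" and strip: "\<And>p. p \<in> Z \<Longrightarrow> l \<le> fst p - snd p \<and> fst p - snd p < l + 1"
    and "s > 1" "\<delta> > 0"
  shows "hausdorff_pre s \<delta> Z = 0"
proof -
  have bound: "hausdorff_pre s \<delta> Z \<le> ennreal (real N powr (1 - s))" if N: "N > 0" "1 / real N \<le> \<delta>" for N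
  proof -
    \<comment> \<open>The sequence is filled up with empty sets, to which \<open>hsize\<close> gives
      0, so the series has only \<open>N\<close> relevant terms.\<close>
    define C where "C i = (if i < N then {p \<in> Z. l + real i / real N \<le> fst p - snd p \<and>
       fst p - snd p < l + (real i + 1) / real N} else {})" for i
    have close: "dist p q \<le> 1 / real N" if "p \<in> C i" "q \<in> C i" for p q i
    proof -
      have "dist p q \<le> \<bar>(fst p - snd p) - (fst q - snd q)\<bar>"
        using that by (intro dist_antitone[OF Z]) (auto simp: C_def split: if_splits)
      also have "\<dots> \<le> 1 / real N"
        using that by (auto simp: C_def add_divide_distrib split: if_splits)
      finally show ?thesis .
    qed
    have bdd: "bounded (C i)" for i
      unfolding bounded_two_points using close[of _ i] by blast
    have diam: "diameter (C i) \<le> 1 / real N" for i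
      using N close[of _ i] by (intro diameter_le) (auto simp: dist_norm)
    have "hausdorff_pre s \<delta> Z \<le> (\<Sum>i. ennreal (hsize s (C i)))"
    proof (rule hausdorff_pre_le)
      show "Z \<subseteq> (\<Union>i. C i)"
      proof
        fix p assume p: "p \<in> Z"
        define i where "i = nat \<lfloor>(fst p - snd p - l) * N\<rfloor>"
        have r: "0 \<le> (fst p - snd p - l) * N" "(fst p - snd p - l) * N < N"
          using strip[OF p] N by auto
        have i: "real i \<le> (fst p - snd p - l) * N" "(fst p - snd p - l) * N < real i + 1"
          using r unfolding i_def by linarith+
        then have "i < N" using r by linarith
        then have "p \<in> C i" using p i N by (simp add: C_def field_simps)
        then show "p \<in> (\<Union>i. C i)" by blast
      qed
      show "diameter (C i) \<le> \<delta>" for i using diam[of i] N by simp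
    qed (fact bdd)
    also have "\<dots> = (\<Sum>i<N. ennreal (hsize s (C i)))"
      by (rule suminf_finite) (auto simp: C_def hsize_def)
    also have "\<dots> \<le> (\<Sum>i<N. ennreal ((1 / real N) powr s))"
      using diam diameter_ge_0[OF bdd] \<open>s > 1\<close>
      by (intro sum_mono ennreal_leI) (auto simp: hsize_def intro!: powr_mono2)
    also have "\<dots> = ennreal (real N * (1 / real N) powr s)"
      by (simp add: ennreal_mult ennreal_of_nat_eq_real_of_nat)
    also have "real N * (1 / real N) powr s = real N powr (1 - s)"
      using N by (simp add: powr_divide powr_diff)
    finally show ?thesis .
  qed
  have "((\<lambda>N. real N powr (1 - s)) \<longlongrightarrow> 0) sequentially"
    using \<open>s > 1\<close> by (intro tendsto_neg_powr filterlim_real_sequentially) auto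
  then have "((\<lambda>N. ennreal (real N powr (1 - s))) \<longlongrightarrow> ennreal 0) sequentially"
    by (intro tendsto_ennrealI)
  moreover have "eventually (\<lambda>N. N > 0 \<and> 1 / real N \<le> \<delta>) sequentially"
  proof (rule eventually_conj)
    have "((\<lambda>N. 1 / real N) \<longlongrightarrow> 0) sequentially" by (rule lim_1_over_n)
    then show "eventually (\<lambda>N. 1 / real N \<le> \<delta>) sequentially"
      using \<open>\<delta> > 0\<close> by (auto dest!: order_tendstoD(2)[of _ _ _ \<delta>] elim: eventually_mono)
  qed (rule eventually_gt_at_top)
  then have "eventually (\<lambda>N. hausdorff_pre s \<delta> Z \<le> ennreal (real N powr (1 - s))) sequentially"
    by eventually_elim (use bound in auto)
  ultimately have "hausdorff_pre s \<delta> Z \<le> ennreal 0"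
    by (rule tendsto_lowerbound) simp
  then show ?thesis by simp
qed

text \<open>The integer part of \<open>fst p - snd p\<close> splits \<open>Z\<close> into countably
  many strips of unit width.\<close>

lemma hausdorff_pre_antitone:
  assumes Z: "antitone_set Z" and s: "s > 1" "\<delta> > 0"
  shows "hausdorff_pre s \<delta> Z = 0"
proof -
  define Y where "Y m = {p \<in> Z. \<lfloor>fst p - snd p\<rfloor> = (from_nat m :: int)}" for m
  have "hausdorff_pre s \<delta> (Y m) = 0" for m
  proof (rule hausdorff_pre_antitone_strip[OF _ _ s, where l = "of_int (from_nat m)"])
    show "antitone_set (Y m)" using Z by (auto simp: antitone_set_def Y_def)
  qed (simp add: Y_def, linarith)
  then have "hausdorff_pre s \<delta> (\<Union>m. Y m) = 0" by (rule hausdorff_pre_UN_eq_0)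
  moreover have "Z \<subseteq> (\<Union>m. Y m)"
    by (auto simp: Y_def) (metis from_nat_to_nat)
  ultimately show ?thesis using hausdorff_pre_mono[of Z "\<Union>m. Y m" s \<delta>] by simp
qed

section \<open>Countable antitone cover and the upper bound\<close>

lemma Omega_covered:
  obtains Z where "Omega_P \<union> Omega_Q \<subseteq> (\<Union>m::nat. Z m)" "\<And>m. antitone_set (Z m)"
proof -
  define I where "I = (SIGMA n:{2..}. Pow {..<n::nat})"
  have "countable I" unfolding I_def
    by (intro countable_SIGMA) (auto intro: countable_finite)
  moreover have "I \<noteq> {}" by (auto simp: I_def)
  ultimately have I: "range (from_nat_into I) = I" by (intro range_from_nat_into) auto
  define Z where "Z m = (case from_nat_into I m of (n, J) \<Rightarrow> sign_curve n J)" for m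
  have "Omega_P \<union> Omega_Q \<subseteq> (\<Union>m. Z m)"
  proof
    fix p assume "p \<in> Omega_P \<union> Omega_Q"
    then have "p \<in> (\<Union>n\<in>{2..}. \<Union>J\<in>Pow {..<n}. sign_curve n J)"
      by (rule subsetD[OF Omega_subset_sign_curves])
    then obtain n J where nJ: "n \<in> {2..}" "J \<in> Pow {..<n}" "p \<in> sign_curve n J" by blast
    then have "(n, J) \<in> range (from_nat_into I)" unfolding I by (simp add: I_def)
    then obtain m where "from_nat_into I m = (n, J)" by (metis rangeE)
    then have "p \<in> Z m" using nJ by (simp add: Z_def)
    then show "p \<in> (\<Union>m. Z m)" by blast
  qed
  moreover have "antitone_set (Z m)" for m
  proof -
    have "from_nat_into I m \<in> I" using \<open>I \<noteq> {}\<close> by (rule from_nat_into)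
    then show ?thesis by (auto simp: Z_def I_def split: prod.split intro!: antitone_sign_curve)
  qed
  ultimately show ?thesis by (rule that)
qed

lemma null_sets_Omega: "Omega_P \<union> Omega_Q \<in> null_sets lebesgue"
proof -
  obtain Z where Z: "Omega_P \<union> Omega_Q \<subseteq> (\<Union>m::nat. Z m)" "\<And>m. antitone_set (Z m)"
    using Omega_covered by blast
  have "negligible (\<Union>m. Z m)"
    using Z(2) by (intro negligible_countable_Union) (auto intro: negligible_antitone)
  then show ?thesis using Z(1) negligible_subset negligible_iff_null_sets by blast
qed

lemma hausdorff_measure_Omega_eq_0:
  assumes "s > 1" shows "hausdorff_measure s (Omega_P \<union> Omega_Q) = 0"
proof -
  obtain Z where Z: "Omega_P \<union> Omega_Q \<subseteq> (\<Union>m::nat. Z m)" "\<And>m. antitone_set (Z m)"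
    using Omega_covered by blast
  have "hausdorff_pre s \<delta> (Omega_P \<union> Omega_Q) = 0" if "\<delta> > 0" for \<delta>
  proof -
    have "hausdorff_pre s \<delta> (\<Union>m. Z m) = 0"
      using Z(2) assms that by (intro hausdorff_pre_UN_eq_0 hausdorff_pre_antitone)
    then show ?thesis using hausdorff_pre_mono[OF Z(1), of s \<delta>] by simp
  qed
  then have "hausdorff_measure s (Omega_P \<union> Omega_Q) \<le> 0"
    unfolding hausdorff_measure_def by (intro SUP_least) simp
  then show ?thesis by simp
qed

section \<open>Circle maps without periodic points\<close>

lemma circ_eq_iff: "circ s = circ t \<longleftrightarrow> (\<exists>k::int. s = t + of_int k)"
proof -
  have "circ s = circ t \<longleftrightarrow> (\<exists>k::int. 2 * pi * s = 2 * pi * t + 2 * pi * k)"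
    unfolding circ_def by (simp add: sin_cos_eq_iff[symmetric] conj_commute)
  also have "\<dots> \<longleftrightarrow> (\<exists>k::int. s = t + of_int k)"
    by (intro ex_cong1) (auto simp flip: distrib_left)
  finally show ?thesis .
qed

lemma norm_circ [simp]: "norm (circ t) = 1"
  by (simp add: circ_def norm_Pair)

lemma continuous_on_circ: "continuous_on UNIV circ"
  unfolding circ_def by (intro continuous_intros)

text \<open>The pulled-back map has no zero on the contractible real line, so it has a continuous
  logarithm; modulus 1 makes this purely imaginary, and its imaginary part over 2 pi is the
  lift.\<close>

lemma circle_map_lift:
  assumes "continuous_on (sphere 0 1) S" "S ` sphere 0 1 \<subseteq> sphere 0 1"
  obtains F :: "real \<Rightarrow> real" where "continuous_on UNIV F" "\<And>t. circ (F t) = S (circ t)"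
proof -
  define f where "f t = Complex (fst (S (circ t))) (snd (S (circ t)))" for t
  have cont: "continuous_on UNIV (\<lambda>t. S (circ t))"
    by (rule continuous_on_compose2[OF assms(1) continuous_on_circ]) auto
  have "continuous_on UNIV f"
    unfolding f_def Complex_eq by (intro continuous_intros cont)
  moreover have norm_f: "norm (f t) = 1" for t
  proof -
    have "S (circ t) \<in> sphere 0 1" using assms(2) by (rule subsetD) simp
    then show ?thesis by (simp add: f_def complex_norm norm_prod_def)
  qed
  moreover have "f t \<noteq> 0" for t using norm_f[of t] by auto
  ultimately obtain g where g: "continuous_on UNIV g" "\<And>t. f t = exp (g t)"
    by (metis continuous_logarithm_on_contractible convex_UNIV convex_imp_contractible UNIV_I)
  have Re: "Re (g t) = 0" for t using norm_f[of t] g(2)[of t] by simp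
  show thesis
  proof
    show "continuous_on UNIV (\<lambda>t. Im (g t) / (2 * pi))" using g(1) by (intro continuous_intros) auto
    fix t
    have "fst (S (circ t)) = Re (exp (g t))" "snd (S (circ t)) = Im (exp (g t))"
      by (simp_all flip: g(2) add: f_def)
    then show "circ (Im (g t) / (2 * pi)) = S (circ t)"
      by (simp add: circ_def prod_eq_iff Re_exp Im_exp Re)
  qed
qed

section \<open>Rotation numbers of monotone degree one lifts\<close>

locale degree_one_lift =
  fixes F :: "real \<Rightarrow> real"
  assumes cont: "continuous_on UNIV F"
    and mono: "mono F"
    and shift: "\<And>t. F (t + 1) = F t + 1"
begin

lemma pow_mono: "x \<le> y \<Longrightarrow> (F ^^ n) x \<le> (F ^^ n) y"
  by (induction n) (auto intro: monoD[OF mono])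

lemma pow_cont: "continuous_on UNIV (F ^^ n)"
proof (induction n)
  case (Suc n)
  have "continuous_on UNIV (\<lambda>x. F ((F ^^ n) x))"
    by (rule continuous_on_compose2[OF cont Suc]) auto
  then show ?case by (simp add: o_def)
qed (simp add: id_def)

lemma pow_shift: "(F ^^ n) (t + 1) = (F ^^ n) t + 1"
  by (induction n) (auto simp: shift)

lemma pow_shift_nat: "(F ^^ n) (t + real k) = (F ^^ n) t + real k"
proof (induction k)
  case (Suc k)
  then show ?case using pow_shift[of n "t + real k"] by (simp add: add_ac)
qed simp

lemma pow_shift_int: "(F ^^ n) (t + of_int k) = (F ^^ n) t + of_int k"
proof (cases "k \<ge> 0")
  case True
  then show ?thesis using pow_shift_nat[of n t "nat k"] by simp
next
  case False
  then show ?thesis using pow_shift_nat[of n "t + of_int k" "nat (- k)"] by simp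
qed

text \<open>Iterates commute with integer translations, so monotonicity traps the value at
  \<open>t\<close> between the values at the neighbouring integers.\<close>

lemma pow_displacement: "\<bar>(F ^^ n) t - t - (F ^^ n) 0\<bar> \<le> 1"
proof -
  have "(F ^^ n) (of_int \<lfloor>t\<rfloor>) \<le> (F ^^ n) t" "(F ^^ n) t \<le> (F ^^ n) (of_int \<lfloor>t\<rfloor> + 1)"
    by (intro pow_mono; linarith)+
  moreover have "(F ^^ n) (of_int \<lfloor>t\<rfloor>) = (F ^^ n) 0 + of_int \<lfloor>t\<rfloor>"
    using pow_shift_int[of n 0 "\<lfloor>t\<rfloor>"] by simp
  ultimately show ?thesis using pow_shift[of n "of_int \<lfloor>t\<rfloor>"] by linarith
qed

lemma pow_mult_displacement: "\<bar>(F ^^ (m * n)) 0 - real m * (F ^^ n) 0\<bar> \<le> real m"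
proof (induction m)
  case (Suc m)
  have "(F ^^ (Suc m * n)) 0 = (F ^^ n) ((F ^^ (m * n)) 0)" by (simp add: funpow_add)
  then have "\<bar>(F ^^ (Suc m * n)) 0 - (F ^^ (m * n)) 0 - (F ^^ n) 0\<bar> \<le> 1"
    using pow_displacement[of n "(F ^^ (m * n)) 0"] by simp
  then show ?case using Suc by (simp add: algebra_simps)
qed simp

text \<open>The means at times m and n are both compared with the mean at time m n, which makes the
  sequence Cauchy.\<close>

lemma convergent_mean_displacement: "convergent (\<lambda>n. (F ^^ n) 0 / real n)"
proof -
  have half: "\<bar>(F ^^ (m * n)) 0 / real (m * n) - (F ^^ n) 0 / real n\<bar> \<le> 1 / real n"
    if "m > 0" "n > 0" for m n
  proof -
    have "(F ^^ (m * n)) 0 / real (m * n) - (F ^^ n) 0 / real n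
        = ((F ^^ (m * n)) 0 - real m * (F ^^ n) 0) / (real m * real n)"
      using that by (simp add: field_simps)
    then have "\<bar>(F ^^ (m * n)) 0 / real (m * n) - (F ^^ n) 0 / real n\<bar>
        = \<bar>(F ^^ (m * n)) 0 - real m * (F ^^ n) 0\<bar> / (real m * real n)"
      by (simp add: abs_mult)
    also have "\<dots> \<le> real m / (real m * real n)"
      by (intro divide_right_mono pow_mult_displacement) auto
    finally show ?thesis using that by simp
  qed
  have close: "\<bar>(F ^^ m) 0 / real m - (F ^^ n) 0 / real n\<bar> \<le> 1 / real m + 1 / real n"
    if "m > 0" "n > 0" for m n
    using half[of m n] half[of n m] that by (simp add: mult.commute[of n m])
  have "Cauchy (\<lambda>n. (F ^^ n) 0 / real n)"
  proof (rule metric_CauchyI)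
    fix e :: real assume "e > 0"
    obtain N where N: "N > 0" "1 / real N < e / 2"
      using \<open>e > 0\<close> reals_Archimedean[of "e / 2"] by (metis half_gt_zero inverse_eq_divide zero_less_Suc)
    have "dist ((F ^^ m) 0 / real m) ((F ^^ n) 0 / real n) < e" if "m \<ge> N" "n \<ge> N" for m n
    proof -
      have "1 / real m \<le> 1 / real N" "1 / real n \<le> 1 / real N"
        using that N by (auto intro!: divide_left_mono)
      then show ?thesis using close[of m n] that N by (simp add: dist_real_def)
    qed
    then show "\<exists>M. \<forall>m\<ge>M. \<forall>n\<ge>M. dist ((F ^^ m) 0 / real m) ((F ^^ n) 0 / real n) < e" by blast
  qed
  then show ?thesis by (simp add: real_Cauchy_convergent)
qed

text \<open>The signed excess has a positive minimum by compactness. Over n blocks of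
  \<open>q\<close> steps it accumulates at least n times, which survives division by n q. The factor
  \<open>\<sigma>\<close> treats both signs at once.\<close>

lemma mean_displacement_gap:
  assumes "0 < q" "\<sigma> \<in> {1, -1}" "\<And>t. \<sigma> * ((F ^^ q) t - t - of_int p) > 0"
  shows "\<sigma> * (lim (\<lambda>n. (F ^^ n) 0 / real n) - of_int p / real q) > 0"
proof -
  define h where "h t = \<sigma> * ((F ^^ q) t - t - of_int p)" for t
  have "continuous_on {0..1} h"
    unfolding h_def by (intro continuous_intros continuous_on_subset[OF pow_cont]) auto
  then obtain t0 where t0: "\<And>t. t \<in> {0..1} \<Longrightarrow> h t0 \<le> h t"
    using continuous_attains_inf[of "{0..1::real}" h] by (metis atLeastAtMost_iff compact_Icc empty_iff zero_le_one order_refl)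
  define \<epsilon> where "\<epsilon> = h t0"
  have "\<epsilon> > 0" using assms(3) by (simp add: \<epsilon>_def h_def)
  \<comment> \<open>\<open>h\<close> has period 1, so its minimum over the unit interval is a global
    one.\<close>
  have ge: "h t \<ge> \<epsilon>" for t
  proof -
    have "h t = h (frac t)"
      using pow_shift_int[of q "frac t" "\<lfloor>t\<rfloor>"] by (simp add: h_def frac_def)
    then show ?thesis using t0[of "frac t"] frac_lt_1[of t] by (simp add: \<epsilon>_def less_imp_le)
  qed
  have growth: "\<sigma> * ((F ^^ (n * q)) 0 - real n * of_int p) \<ge> real n * \<epsilon>" for n
  proof (induction n)
    case (Suc n)
    have "(F ^^ (Suc n * q)) 0 = (F ^^ q) ((F ^^ (n * q)) 0)" by (simp add: funpow_add)
    then show ?case using Suc ge[of "(F ^^ (n * q)) 0"] by (simp add: h_def algebra_simps)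
  qed simp
  define L where "L = lim (\<lambda>n. (F ^^ n) 0 / real n)"
  have "(\<lambda>n. (F ^^ n) 0 / real n) \<longlonglongrightarrow> L"
    unfolding L_def using convergent_mean_displacement by (simp add: convergent_LIMSEQ_iff)
  then have "((\<lambda>n. (F ^^ n) 0 / real n) \<circ> (\<lambda>n. n * q)) \<longlonglongrightarrow> L"
    using \<open>0 < q\<close> by (intro LIMSEQ_subseq_LIMSEQ) (auto simp: strict_mono_def)
  then have "(\<lambda>n. \<sigma> * ((F ^^ (n * q)) 0 / real (n * q) - of_int p / real q)) \<longlonglongrightarrow> \<sigma> * (L - of_int p / real q)"
    by (intro tendsto_intros) (simp add: o_def)
  moreover have "\<epsilon> / real q \<le> \<sigma> * ((F ^^ (n * q)) 0 / real (n * q) - of_int p / real q)" if "n > 0" for n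
  proof -
    have "\<sigma> * ((F ^^ (n * q)) 0 / real (n * q) - of_int p / real q)
        = \<sigma> * ((F ^^ (n * q)) 0 - real n * of_int p) / (real n * real q)"
      using that \<open>0 < q\<close> by (simp add: field_simps)
    also have "\<dots> \<ge> (real n * \<epsilon>) / (real n * real q)"
      by (intro divide_right_mono growth) auto
    finally show ?thesis using that by simp
  qed
  then have "eventually (\<lambda>n. \<epsilon> / real q \<le> \<sigma> * ((F ^^ (n * q)) 0 / real (n * q) - of_int p / real q)) sequentially"
    by (intro eventually_mono[OF eventually_gt_at_top[of 0]])
  ultimately have "\<epsilon> / real q \<le> \<sigma> * (L - of_int p / real q)"
    by (rule tendsto_lowerbound) simp
  moreover have "\<epsilon> / real q > 0" using \<open>\<epsilon> > 0\<close> \<open>0 < q\<close> by simp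
  ultimately show ?thesis unfolding L_def by linarith
qed

end

lemma continuous_nonzero_sign:
  fixes h :: "real \<Rightarrow> real"
  assumes "continuous_on UNIV h" "\<And>t. h t \<noteq> 0"
  obtains \<sigma> where "\<sigma> \<in> {1, -1}" "\<And>t. \<sigma> * h t > 0"
proof -
  have "connected (range h)" using assms(1) by (rule connected_continuous_image) simp
  then have "0 \<in> range h" if "h s < 0" "h t > 0" for s t
    using that connectedD_interval[of "range h" "h s" "h t" 0] by auto
  then have "(\<forall>t. h t > 0) \<or> (\<forall>t. h t < 0)"
    using assms(2) by (metis linorder_neqE_linordered_idom rangeE)
  then show thesis using that[of 1] that[of "-1"] by auto
qed

lemma lift_pow: "(\<And>t. circ (F t) = S (circ t)) \<Longrightarrow> circ ((F ^^ n) t) = (S ^^ n) (circ t)"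
  by (induction n) auto

text \<open>Without fixed points, F t - t avoids the integers and stays in one unit interval. That
  forces degree 1; injectivity on the circle then lifts to \<open>F\<close>, and a continuous
  injective map of degree 1 increases.\<close>

lemma degree_one_lift_if_no_fixed_point:
  assumes cont: "continuous_on UNIV F" and lift: "\<And>t. circ (F t) = S (circ t)"
    and inj: "inj_on S (sphere 0 1)" and nofix: "\<And>t. S (circ t) \<noteq> circ t"
  shows "degree_one_lift F"
proof -
  define N where "N = \<lfloor>F 0\<rfloor>"
  have nonint: "F t - t \<noteq> of_int k" for t k
    using nofix[of t] lift[of t] circ_eq_iff[of "F t" t] by (auto simp: algebra_simps)
  have range: "of_int N < F t - t \<and> F t - t < of_int N + 1" for t
  proof -
    \<comment> \<open>Each F t - t - k keeps one sign, which is read off at t = 0 for k =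
      \<open>N\<close> and k = \<open>N + 1\<close>.\<close>
    have sign: "\<exists>\<sigma>\<in>{1, -1}. \<forall>t. \<sigma> * (F t - t - of_int k) > 0" for k :: int
      by (rule continuous_nonzero_sign[of "\<lambda>t. F t - t - of_int k"])
         (use nonint in \<open>auto intro!: continuous_intros cont\<close>)
    have "F 0 - 0 > of_int N" "F 0 - 0 < of_int (N + 1)"
      using nonint[of 0 N] unfolding N_def by linarith+
    then show ?thesis
      using sign[of N] sign[of "N + 1"] by simp (metis add.commute diff_0_right less_asym)
  qed
  have shift: "F (t + 1) = F t + 1" for t
  proof -
    have "circ (F (t + 1)) = circ (F t)"
      using lift circ_eq_iff[of "t + 1" t] by (metis of_int_1)
    then obtain k :: int where "F (t + 1) = F t + of_int k" using circ_eq_iff by blast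
    \<comment> \<open>The displacements at \<open>t\<close> and \<open>t + 1\<close> differ by k - 1
      and by less than 1, so k = 1.\<close>
    then show ?thesis using range[of t] range[of "t + 1"] by simp
  qed
  have shift_nat: "F (t + real k) = F t + real k" for t k
  proof (induction k)
    case (Suc k)
    then show ?case using shift[of "t + real k"] by (simp add: add_ac)
  qed simp
  have inj_F: "s = t" if "F s = F t" for s t
  proof -
    have eq: "s = t" if FF: "F s = F t" and "t \<le> s" for s t
    proof -
      have "circ s = circ t" using inj lift FF by (metis inj_onD dist_0_norm mem_sphere norm_circ)
      then obtain k :: int where k: "s = t + of_int k" using circ_eq_iff by blast
      then have "s = t + real (nat k)" using \<open>t \<le> s\<close> by simp
      then show ?thesis using shift_nat[of t "nat k"] FF by simp
    qed
    show ?thesis using eq[of s t] eq[of t s] that by (cases "t \<le> s") auto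
  qed
  have "F s \<le> F t" if "s < t" for s t
  proof -
    \<comment> \<open>A long interval from \<open>s\<close> contains \<open>t\<close> inside, and
      its endpoint values increase by \<open>k\<close>; this excludes the decreasing
      alternative.\<close>
    obtain k where k: "real k > t - s + 1" using reals_Archimedean2 by blast
    then have "F s < F (s + real k)" using shift_nat[of s k] that by simp
    moreover have "inj_on F {s..s + real k}" using inj_F by (auto simp: inj_on_def)
    ultimately show ?thesis
      using continuous_inj_imp_mono[of s t "s + real k" F] continuous_on_subset[OF cont] k that
      by fastforce
  qed
  then have "mono F" by (intro monoI) (metis order_le_less)
  then show ?thesis using cont shift by unfold_locales
qed

text \<open>If the mean displacement were p/q, the gap lemma would forbid F^q t - t - p from keeping
  one sign; a zero of it is a periodic point of \<open>S\<close>.\<close>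

lemma irrational_rotation_number:
  assumes cont: "continuous_on (sphere 0 1) S" and image: "S ` sphere 0 1 \<subseteq> sphere 0 1"
    and inj: "inj_on S (sphere 0 1)"
    and aperiodic: "\<And>n u. n > 0 \<Longrightarrow> norm u = 1 \<Longrightarrow> (S ^^ n) u \<noteq> u"
  shows "rotation_number S \<notin> \<rat>"
proof -
  \<comment> \<open>This is the very lift that \<open>rotation_number\<close> selects.\<close>
  define F where "F = (SOME F. continuous_on UNIV F \<and> (\<forall>t. circ (F t) = S (circ t)))"
  have "\<exists>F. continuous_on UNIV F \<and> (\<forall>t. circ (F t) = S (circ t))"
    using circle_map_lift[OF cont image] by metis
  then have "continuous_on UNIV F \<and> (\<forall>t. circ (F t) = S (circ t))"
    unfolding F_def by (rule someI_ex)
  then have F: "continuous_on UNIV F" "\<And>t. circ (F t) = S (circ t)" by auto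
  have "S (circ t) \<noteq> circ t" for t using aperiodic[of 1 "circ t"] by simp
  from degree_one_lift_if_no_fixed_point[OF F inj this] interpret degree_one_lift F .
  define L where "L = lim (\<lambda>n. (F ^^ n) 0 / real n)"
  have "L \<notin> \<rat>"
  proof
    assume "L \<in> \<rat>"
    then obtain p q where pq: "q > 0" "L = of_int p / of_int q" by (rule Rats_cases')
    then have q: "nat q > 0" "L = of_int p / real (nat q)" by auto
    have "(F ^^ nat q) t - t - of_int p \<noteq> 0" for t
    proof
      assume "(F ^^ nat q) t - t - of_int p = 0"
      then have "circ ((F ^^ nat q) t) = circ t" unfolding circ_eq_iff by (intro exI[of _ p]) simp
      then show False using lift_pow[of F S "nat q" t, OF F(2)] aperiodic[of "nat q" "circ t"] q by simp
    qed
    moreover have "continuous_on UNIV (\<lambda>t. (F ^^ nat q) t - t - of_int p)"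
      by (intro continuous_intros pow_cont)
    ultimately obtain \<sigma> where "\<sigma> \<in> {1, -1}" "\<And>t. \<sigma> * ((F ^^ nat q) t - t - of_int p) > 0"
      using continuous_nonzero_sign[of "\<lambda>t. (F ^^ nat q) t - t - of_int p"] by blast
    from mean_displacement_gap[OF q(1) this] q(2) show False by (simp add: L_def)
  qed
  moreover have "rotation_number S = L - of_int \<lfloor>L\<rfloor>"
    by (simp add: rotation_number_def F_def L_def frac_def)
  ultimately show ?thesis by (metis Rats_add Rats_of_int diff_add_cancel)
qed

section \<open>The segment \<open>b = 0\<close>\<close>

text \<open>The branch of \<open>T_map\<close> on the right half-plane, extended linearly to the
  whole plane; it is elliptic when |a| < 2.\<close>

definition shear :: "real \<Rightarrow> real \<times> real \<Rightarrow> real \<times> real" where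
  "shear a p = (a * fst p - snd p, fst p)"

lemma T_map_nonneg: "fst p \<ge> 0 \<Longrightarrow> T_map a b p = shear a p"
  by (simp add: T_map_def shear_def)

lemma shear_minus: "shear a (- p) = - shear a p"
  by (simp add: shear_def prod_eq_iff)

text \<open>Cayley-Hamilton for trace 2 cos \<theta> and determinant 1: the coefficients obey the
  three-term sine recurrence and are Chebyshev values of the second kind.\<close>

lemma shear_pow:
  assumes "sin \<theta> \<noteq> 0"
  shows "(shear (2 * cos \<theta>) ^^ m) v
    = (sin (m * \<theta>) / sin \<theta>) *\<^sub>R shear (2 * cos \<theta>) v - (sin (m * \<theta> - \<theta>) / sin \<theta>) *\<^sub>R v"
proof (induction m)
  case 0
  then show ?case using assms by simp
next
  case (Suc m)
  have sin_Suc: "sin (Suc m * \<theta>) = 2 * cos \<theta> * sin (m * \<theta>) - sin (m * \<theta> - \<theta>)"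
    by (simp add: distrib_right sin_add sin_diff)
  have "(shear (2 * cos \<theta>) ^^ Suc m) v =
      (sin (m * \<theta>) / sin \<theta>) *\<^sub>R ((2 * cos \<theta>) *\<^sub>R shear (2 * cos \<theta>) v - v)
      - (sin (m * \<theta> - \<theta>) / sin \<theta>) *\<^sub>R shear (2 * cos \<theta>) v"
    by (simp add: Suc.IH) (simp add: shear_def prod_eq_iff algebra_simps)
  also have "\<dots> = (sin (Suc m * \<theta>) / sin \<theta>) *\<^sub>R shear (2 * cos \<theta>) v - (sin (m * \<theta>) / sin \<theta>) *\<^sub>R v"
    unfolding sin_Suc using assms by (simp add: prod_eq_iff field_simps)
  also have "m * \<theta> = Suc m * \<theta> - \<theta>" by (simp add: algebra_simps)
  finally show ?case by simp
qed

text \<open>Irrationality makes the coefficient of \<open>shear\<close> in its m-th power nonzero,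
  so an eigenvector of the power would be one of \<open>shear\<close> itself, whose characteristic
  polynomial has no real root.\<close>

lemma shear_pow_no_eigenvector:
  assumes "\<alpha> \<notin> \<rat>" "m > 0" "v \<noteq> 0"
  shows "(shear (2 * cos (pi * \<alpha>)) ^^ m) v \<noteq> \<mu> *\<^sub>R v"
proof
  define \<theta> where "\<theta> = pi * \<alpha>"
  assume eq: "(shear (2 * cos (pi * \<alpha>)) ^^ m) v = \<mu> *\<^sub>R v"
  have sin_nz: "sin (real k * \<theta>) \<noteq> 0" if "k > 0" for k
  proof
    assume "sin (real k * \<theta>) = 0"
    then obtain i :: int where "real k * \<theta> = of_int i * pi" by (auto simp: sin_zero_iff_int2)
    then have "\<alpha> = of_int i / real k" using that by (simp add: \<theta>_def field_simps)
    then show False using \<open>\<alpha> \<notin> \<rat>\<close> by simp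
  qed
  have s: "sin \<theta> \<noteq> 0" "sin (real m * \<theta>) \<noteq> 0" using sin_nz[of 1] sin_nz[of m] assms by auto
  define c where "c = (\<mu> + sin (m * \<theta> - \<theta>) / sin \<theta>) * (sin \<theta> / sin (m * \<theta>))"
  have "(sin (m * \<theta>) / sin \<theta>) *\<^sub>R shear (2 * cos \<theta>) v = (\<mu> + sin (m * \<theta> - \<theta>) / sin \<theta>) *\<^sub>R v"
    using eq shear_pow[OF s(1), of m v] by (simp add: \<theta>_def scaleR_left_distrib algebra_simps)
  then have eigen: "shear (2 * cos \<theta>) v = c *\<^sub>R v"
    using s by (simp add: c_def prod_eq_iff field_simps)
  have x: "fst v = c * snd v" using arg_cong[OF eigen, of snd] by (simp add: shear_def)
  have "2 * cos \<theta> * fst v - snd v = c * fst v"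
    using arg_cong[OF eigen, of fst] by (simp add: shear_def)
  with x have "snd v * (c\<^sup>2 - 2 * cos \<theta> * c + 1) = 0" by (simp add: power2_eq_square algebra_simps)
  moreover have "snd v \<noteq> 0" using x \<open>v \<noteq> 0\<close> by (auto simp: prod_eq_iff)
  moreover have "c\<^sup>2 - 2 * cos \<theta> * c + 1 = (c - cos \<theta>)\<^sup>2 + (sin \<theta>)\<^sup>2"
    by (simp add: power2_diff sin_squared_eq)
  moreover have "(sin \<theta>)\<^sup>2 > 0" using s by simp
  ultimately show False by (smt (verit) mult_eq_0_iff zero_le_power2)
qed

text \<open>On the open left half-plane the map with \<open>b = 0\<close> is a quarter turn, so an orbit leaving the
  right half-plane at \<open>w\<close> comes back at \<open>- w\<close>: up to sign only the linear map \<open>shear a\<close> acts.\<close>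

lemma T_map_orbit_shear:
  assumes "fst v > 0"
  shows "\<exists>m w. (w = (shear a ^^ m) v \<or> w = - (shear a ^^ m) v) \<and> (n > 0 \<longrightarrow> m > 0) \<and>
    ((T_map a 0 ^^ n) v = w \<and> (fst w \<ge> 0 \<or> snd w \<ge> 0)
     \<or> (T_map a 0 ^^ n) v = (- snd w, fst w) \<and> fst w < 0 \<and> snd w \<ge> 0)"
proof (induction n)
  case 0
  then show ?case using assms by (intro exI[of _ 0] exI[of _ v]) auto
next
  case (Suc n)
  then obtain m w where w: "w = (shear a ^^ m) v \<or> w = - (shear a ^^ m) v" "n > 0 \<longrightarrow> m > 0"
    and or: "(T_map a 0 ^^ n) v = w \<and> (fst w \<ge> 0 \<or> snd w \<ge> 0)
     \<or> (T_map a 0 ^^ n) v = (- snd w, fst w) \<and> fst w < 0 \<and> snd w \<ge> 0" by blast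
  have T: "(T_map a 0 ^^ Suc n) v = T_map a 0 ((T_map a 0 ^^ n) v)" by simp
  \<comment> \<open>The three phases are: linear motion on the right, arrival in the second
    quadrant, and the point one quarter turn later. The third quadrant is not entered by
    \<open>w\<close>, since \<open>snd (shear a w) = fst w\<close>.\<close>
  consider "(T_map a 0 ^^ n) v = w" "fst w \<ge> 0" | "(T_map a 0 ^^ n) v = w" "fst w < 0" "snd w \<ge> 0"
    | "(T_map a 0 ^^ n) v = (- snd w, fst w)" "fst w < 0" "snd w \<ge> 0"
    using or by linarith
  then show ?case
  proof cases
    case 1
    have "shear a w = (shear a ^^ Suc m) v \<or> shear a w = - (shear a ^^ Suc m) v"
      using w(1) by (auto simp: shear_minus)
    moreover have "(T_map a 0 ^^ Suc n) v = shear a w" unfolding T using 1 by (simp add: T_map_nonneg)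
    moreover have "snd (shear a w) \<ge> 0" using 1 by (simp add: shear_def)
    ultimately show ?thesis by blast
  next
    case 2
    have "n > 0" using 2 assms by (cases n) auto
    then have "m > 0" using w(2) by blast
    moreover have "(T_map a 0 ^^ Suc n) v = (- snd w, fst w)" unfolding T 2(1) using 2
      by (simp add: T_map_def)
    ultimately show ?thesis using 2 w(1) by blast
  next
    case 3
    have "n > 0" using 3 assms by (cases n) auto
    then have "m > 0" using w(2) by blast
    \<comment> \<open>If \<open>snd w = 0\<close> the current point is on the vertical axis, where
      both branches agree, so the quarter turn is valid there too.\<close>
    moreover have "(T_map a 0 ^^ Suc n) v = - w" unfolding T 3(1) using 3
      by (auto simp: T_map_def prod_eq_iff)
    moreover have "- w = (shear a ^^ m) v \<or> - w = - (shear a ^^ m) v" using w(1) by auto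
    moreover have "fst (- w) \<ge> 0" using 3 by simp
    ultimately show ?thesis by blast
  qed
qed

text \<open>An invariant ray in the open right half-plane would give an eigenvector of a positive
  power of \<open>shear\<close>. Any other invariant ray is moved into that half-plane by at most
  three steps.\<close>

lemma T_map_no_eigendirection:
  assumes "\<alpha> \<notin> \<rat>" "n > 0" "v \<noteq> 0" "c > 0"
  shows "(T_map (2 * cos (pi * \<alpha>)) 0 ^^ n) v \<noteq> c *\<^sub>R v"
proof
  define a where "a = 2 * cos (pi * \<alpha>)"
  assume "(T_map (2 * cos (pi * \<alpha>)) 0 ^^ n) v = c *\<^sub>R v"
  then have per: "(T_map a 0 ^^ n) v = c *\<^sub>R v" by (simp add: a_def)
  have no_pos: False if "fst u > 0" and u: "(T_map a 0 ^^ n) u = c *\<^sub>R u" for u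
  proof -
    have pos: "fst (c *\<^sub>R u) > 0" using that \<open>c > 0\<close> by simp
    obtain m w where w: "w = (shear a ^^ m) u \<or> w = - (shear a ^^ m) u" and "m > 0"
      and or: "c *\<^sub>R u = w \<or> c *\<^sub>R u = (- snd w, fst w) \<and> snd w \<ge> 0"
      using T_map_orbit_shear[of u a n] \<open>fst u > 0\<close> \<open>n > 0\<close> unfolding u by blast
    \<comment> \<open>In the quarter-turn alternative the first coordinate \<open>- snd w\<close> is
      not positive.\<close>
    have "c *\<^sub>R u = w" using or pos by (metis fst_conv neg_0_less_iff_less not_less)
    with w have "c *\<^sub>R u = (shear a ^^ m) u \<or> c *\<^sub>R u = - (shear a ^^ m) u" by simp
    then have "(shear a ^^ m) u = c *\<^sub>R u \<or> (shear a ^^ m) u = (- c) *\<^sub>R u"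
      by (metis minus_minus scaleR_minus_left)
    moreover have "u \<noteq> 0" using that by auto
    ultimately show False
      using shear_pow_no_eigenvector[OF assms(1) \<open>m > 0\<close>] unfolding a_def by blast
  qed
  have per_Suc: "(T_map a 0 ^^ n) (T_map a 0 u) = c *\<^sub>R T_map a 0 u" if "(T_map a 0 ^^ n) u = c *\<^sub>R u" for u
    using that \<open>c > 0\<close> by (simp add: T_map_scaleR flip: funpow_swap1)
  define T where "T = T_map a 0"
  have nonpos: "fst u \<le> 0" if "(T ^^ n) u = c *\<^sub>R u" for u
    using no_pos[of u] that unfolding T_def by (meson not_le)
  \<comment> \<open>The next three iterates span invariant rays as well; four consecutive points in
    the closed left half-plane force \<open>v = 0\<close>.\<close>
  have 1: "(T ^^ n) (T v) = c *\<^sub>R T v" unfolding T_def using per by (rule per_Suc)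
  then have 2: "(T ^^ n) (T (T v)) = c *\<^sub>R T (T v)" unfolding T_def by (rule per_Suc)
  then have 3: "(T ^^ n) (T (T (T v))) = c *\<^sub>R T (T (T v))" unfolding T_def by (rule per_Suc)
  have "fst v \<le> 0" using nonpos per unfolding T_def by blast
  with nonpos[OF 1] nonpos[OF 2] nonpos[OF 3] have "v = 0"
    unfolding T_def T_map_def by (auto simp: prod_eq_iff split: if_splits)
  then show False using \<open>v \<noteq> 0\<close> by simp
qed

section \<open>The circle map at \<open>b = 0\<close> and the lower bound\<close>

lemma continuous_on_T_map: "continuous_on A (T_map a b)"
proof -
  have "T_map a b = (\<lambda>p. (a * max (fst p) 0 + b * min (fst p) 0 - snd p, fst p))"
    by (auto simp: T_map_def fun_eq_iff)
  then show ?thesis by (auto intro!: continuous_intros)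
qed

lemma inj_T_map: "inj (T_map a b)"
  by (rule injI) (auto simp: T_map_def prod_eq_iff split: if_splits)

lemma norm_S_map: "u \<noteq> 0 \<Longrightarrow> norm (S_map a b u) = 1"
  by (simp add: S_map_def)

text \<open>Equal directions of the images give
  \<open>T_map a b u = T_map a b (c *\<^sub>R v)\<close>; unit norms then force
  \<open>c = 1\<close>.\<close>

lemma inj_on_S_map: "inj_on (S_map a b) (sphere 0 1)"
proof (rule inj_onI)
  fix u v assume uv: "u \<in> sphere 0 1" "v \<in> sphere 0 1" and eq: "S_map a b u = S_map a b v"
  then have nz: "norm (T_map a b u) > 0" "norm (T_map a b v) > 0" by auto
  define c where "c = norm (T_map a b u) / norm (T_map a b v)"
  have "c > 0" using nz by (simp add: c_def)
  have "T_map a b u = norm (T_map a b u) *\<^sub>R S_map a b u" using nz by (simp add: S_map_def)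
  also have "\<dots> = c *\<^sub>R T_map a b v" by (subst eq) (simp add: S_map_def c_def)
  also have "\<dots> = T_map a b (c *\<^sub>R v)" using \<open>c > 0\<close> by (simp add: T_map_scaleR)
  finally have "u = c *\<^sub>R v" using inj_T_map by (metis injD)
  then show "u = v" using uv \<open>c > 0\<close> by simp
qed

text \<open>The orbit runs (0, 1), (-1, 0), (0, -1). A periodic point of the circle map would span a
  ray that an iterate of \<open>T_map\<close> preserves.\<close>

lemma irrational_rotation_in_Omega_Q:
  assumes "\<alpha> \<notin> \<rat>"
  shows "(2 * cos (pi * \<alpha>), 0) \<in> Omega_Q"
proof -
  define a where "a = 2 * cos (pi * \<alpha>)"
  have "rotation_number (S_map a 0) \<notin> \<rat>"
  proof (rule irrational_rotation_number)
    show "continuous_on (sphere 0 1) (S_map a 0)"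
      unfolding S_map_def by (intro continuous_intros continuous_on_T_map) auto
    show "S_map a 0 ` sphere 0 1 \<subseteq> sphere 0 1"
    proof (rule image_subsetI)
      fix u :: "real \<times> real" assume "u \<in> sphere 0 1"
      then have "u \<noteq> 0" by auto
      then show "S_map a 0 u \<in> sphere 0 1" by (simp add: norm_S_map)
    qed
    fix n :: nat and u :: "real \<times> real" assume "n > 0" and u: "norm u = 1"
    show "(S_map a 0 ^^ n) u \<noteq> u"
    proof
      assume fixed: "(S_map a 0 ^^ n) u = u"
      have "u \<noteq> 0" using u by auto
      then obtain c where c: "c > 0" "u = c *\<^sub>R (T_map a 0 ^^ n) u"
        using S_map_pow[of u n a 0] fixed by auto
      have "(T_map a 0 ^^ n) u = (1 / c) *\<^sub>R (c *\<^sub>R (T_map a 0 ^^ n) u)" using c(1) by simp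
      then have "(T_map a 0 ^^ n) u = (1 / c) *\<^sub>R u" using c(2) by simp
      then show False
        using T_map_no_eigendirection[OF assms \<open>n > 0\<close> \<open>u \<noteq> 0\<close>, of "1 / c"] c(1) by (simp add: a_def)
    qed
  qed (rule inj_on_S_map)
  moreover have "(S_map a 0 ^^ 2) (0, 1) = (0, - 1)"
    by (simp add: numeral_2_eq_2 S_map_def T_map_def norm_Pair)
  ultimately show ?thesis unfolding Omega_Q_def a_def by blast
qed

text \<open>Projected to the first axis, the cover yields intervals of length twice the diameters
  that cover ]-2, 2[ up to a null set, so 4 \<le> 2 times the sum.\<close>

lemma sum_diameter_Omega_cover:
  assumes "Omega_P \<union> Omega_Q \<subseteq> (\<Union>i. C i)"
    and bdd: "\<And>i. bounded (C i)"
  shows "2 \<le> (\<Sum>i. ennreal (diameter (C i)))"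
proof -
  \<comment> \<open>The countably many parameters that come from rational
    \<open>\<alpha>\<close>.\<close>
  define K where "K = (\<lambda>q. 2 * cos (pi * q)) ` \<rat>"
  have "countable K" by (simp add: K_def countable_rat)
  then have K: "K \<in> null_sets lborel" by (rule countable_imp_null_set_lborel)
  \<comment> \<open>An arbitrary point of \<open>C i\<close> serves as centre; if \<open>C i\<close>
    is empty, the ball is a single point.\<close>
  define x where "x i = fst (SOME p. p \<in> C i)" for i
  have fst_C: "fst ` C i \<subseteq> cball (x i) (diameter (C i))" for i
  proof
    fix y assume "y \<in> fst ` C i"
    then obtain p where p: "p \<in> C i" "y = fst p" by auto
    then have "(SOME p. p \<in> C i) \<in> C i" by (metis someI)
    then have "dist (SOME p. p \<in> C i) p \<le> diameter (C i)"
      using p by (intro diameter_bounded_bound bdd)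
    then show "y \<in> cball (x i) (diameter (C i))"
      using dist_fst_le[of "SOME p. p \<in> C i" p] p by (simp add: x_def)
  qed
  have "{-2<..<2} \<subseteq> (\<Union>i. cball (x i) (diameter (C i))) \<union> K"
  proof
    fix y :: real assume y: "y \<in> {-2<..<2}"
    define \<alpha> where "\<alpha> = arccos (y / 2) / pi"
    have y_eq: "y = 2 * cos (pi * \<alpha>)" using y by (simp add: \<alpha>_def cos_arccos)
    show "y \<in> (\<Union>i. cball (x i) (diameter (C i))) \<union> K"
    proof (cases "\<alpha> \<in> \<rat>")
      case True
      then show ?thesis using y_eq by (auto simp: K_def)
    next
      case False
      then have "(y, 0) \<in> (\<Union>i. C i)" using irrational_rotation_in_Omega_Q assms(1) y_eq by blast
      then obtain i where "(y, 0) \<in> C i" by blast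
      then have "y \<in> fst ` C i" by force
      then show ?thesis using fst_C by blast
    qed
  qed
  then have "emeasure lborel {-2<..<2::real} \<le> emeasure lborel ((\<Union>i. cball (x i) (diameter (C i))) \<union> K)"
    using K by (intro emeasure_mono) auto
  also have "\<dots> = emeasure lborel (\<Union>i. cball (x i) (diameter (C i)))"
    using K by (intro emeasure_Un_null_set) auto
  also have "\<dots> \<le> (\<Sum>i. emeasure lborel (cball (x i) (diameter (C i))))"
    by (intro emeasure_subadditive_countably) auto
  also have "\<dots> = (\<Sum>i. 2 * ennreal (diameter (C i)))"
    using diameter_ge_0[OF bdd]
    by (intro suminf_cong) (simp add: cball_eq_atLeastAtMost ennreal_mult)
  also have "\<dots> = 2 * (\<Sum>i. ennreal (diameter (C i)))" by simp
  finally have "2 * 2 \<le> 2 * (\<Sum>i. ennreal (diameter (C i)))" by simp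
  then show ?thesis by (subst (asm) ennreal_mult_le_mult_iff) auto
qed

text \<open>For d \<le> 1 and s < 1 one has d \<le> d^s, so the bound on sums of diameters already
  bounds the premeasure at scale 1.\<close>

lemma hausdorff_measure_Omega_pos:
  assumes "0 \<le> s" "s < 1"
  shows "hausdorff_measure s (Omega_P \<union> Omega_Q) > 0"
proof -
  have hsize_ge: "diameter D \<le> hsize s D" if "bounded D" "diameter D \<le> 1" for D :: "(real \<times> real) set"
  proof -
    have "d \<le> d powr s" if "0 \<le> d" "d \<le> 1" for d :: real
    proof (cases "d = 0")
      case False
      then show ?thesis using powr_mono'[of s 1 d] assms that by simp
    qed simp
    then show ?thesis using that diameter_ge_0[of D] by (simp add: hsize_def)
  qed
  have "2 \<le> hausdorff_pre s 1 (Omega_P \<union> Omega_Q)"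
    unfolding hausdorff_pre_def
  proof (rule INF_greatest)
    fix C :: "nat \<Rightarrow> (real \<times> real) set"
    assume "C \<in> {C. Omega_P \<union> Omega_Q \<subseteq> (\<Union>i. C i) \<and> (\<forall>i. bounded (C i) \<and> diameter (C i) \<le> 1)}"
    then have C: "Omega_P \<union> Omega_Q \<subseteq> (\<Union>i. C i)" "\<And>i. bounded (C i)" "\<And>i. diameter (C i) \<le> 1" by auto
    have "2 \<le> (\<Sum>i. ennreal (diameter (C i)))" by (rule sum_diameter_Omega_cover) (use C in auto)
    also have "\<dots> \<le> (\<Sum>i. ennreal (hsize s (C i)))"
      using C by (intro suminf_le ennreal_leI hsize_ge) auto
    finally show "2 \<le> (\<Sum>i. ennreal (hsize s (C i)))" .
  qed
  also have "\<dots> \<le> hausdorff_measure s (Omega_P \<union> Omega_Q)"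
    unfolding hausdorff_measure_def by (rule SUP_upper) simp
  finally show ?thesis by (rule less_le_trans[rotated]) simp
qed

theorem theorem5p1:
  shows "hausdorff_dim (Omega_P \<union> Omega_Q) = 1 \<and> Omega_P \<union> Omega_Q \<in> null_sets lebesgue"
proof
  let ?D = "{s. s \<ge> 0 \<and> hausdorff_measure s (Omega_P \<union> Omega_Q) = 0}"
  \<comment> \<open>The exponents of measure zero include ]1, \<infinity>[ and lie in [1,
    \<infinity>[, so their infimum is 1.\<close>
  have upper: "s \<in> ?D" if "s > 1" for s using that hausdorff_measure_Omega_eq_0 by simp
  have lower: "1 \<le> s" if "s \<in> ?D" for s
    using that hausdorff_measure_Omega_pos[of s] by (cases "s < 1") auto
  show "hausdorff_dim (Omega_P \<union> Omega_Q) = 1"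
    unfolding hausdorff_dim_def
  proof (rule cInf_eq_non_empty)
    have "2 \<in> ?D" by (rule upper) simp
    then show "?D \<noteq> {}" by blast
    show "y \<le> 1" if "\<And>s. s \<in> ?D \<Longrightarrow> y \<le> s" for y
      by (rule dense_ge) (intro that upper)
  qed (fact lower)
qed (rule null_sets_Omega)

end
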